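(* Let $H$ be any finite non-empty graph (loops allowed), let $a,b\ge1$ be integers, let $G$ be any finite non-empty $(a,b)$-biregular graph with partition classes $\mathcal{E}_G$ (vertices of degree $a$) and $\mathcal{O}_G$ (vertices of degree $b$), and let $\mathcal{L}=\{L(v):v\in V(G)\}$ be any list set, where $L(v)\subseteq V(H)$ for each $v\in V(G)$. For $v\in\mathcal{O}_G$ let $\mathcal{L}^v$ be the list set on $K_{a,b}$ defined in the context. Then $$ \left|Hom^{\mathcal{L}}(G,H)\right|\ \le\ \prod_{v\in\mathcal{O}_G}\left|Hom^{\mathcal{L}^v}(K_{a,b},H)\right|^{\frac1a}. $$
   Context: Graphs are finite; $G$ is simple, while $H$ may have loops. An $(a,b)$-biregular graph is a bipartite graph $G$ with a bipartition into classes $\mathcal{E}_G$ and $\mathcal{O}_G$ such that every vertex of $\mathcal{E}_G$ has degree $a$ and every vertex of $\mathcal{O}_G$ has degree $b$. $Hom(G,H)$ is the set of functions $f:V(G)\to V(H)$ such that $uv\in E(G)$ implies $f(u)f(v)\in E(H)$. Given a list set $\mathcal{L}=\{L(v):v\in V(G)\}$, i.e. an assignment to each $v\in V(G)$ of a set $L(v)\subseteq V(H)$, $Hom^{\mathcal{L}}(G,H)$ is the set of $f\in Hom(G,H)$ with $f(v)\in L(v)$ for all $v\in V(G)$ (list homomorphisms). $K_{a,b}$ is the complete bipartite graph with $a$ vertices (of degree $b$) in one partition class and $b$ vertices (of degree $a$) in the other. For $v\in\mathcal{O}_G$ with set of neighbours $\{n_1(v),\ldots,n_b(v)\}$ in $G$,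 $\mathcal{L}^v$ is the list set on $K_{a,b}$ in which each of the $a$ vertices of degree $b$ gets the list $L(v)$, and the $b$ vertices of degree $a$ get the lists $L(n_1(v)),\ldots,L(n_b(v))$, one each (the list $L(n_k(v))$ being given to the $k$-th of these vertices). *)

theory Defs
  imports Complex_Main "HOL-Library.FuncSet" "Graph_Theory.Graph_Theory"
begin

text \<open>
  Undirected graphs are symmetric digraphs without parallel arcs, as in \<open>Graph_Theory\<close>:
  \<open>pair_graph\<close> is a finite simple graph, \<open>pair_pseudo_graph\<close> a finite graph that may have loops.
  An edge \<open>uv\<close> is represented by the two arcs \<open>(u, v)\<close> and \<open>(v, u)\<close>.
\<close>

definition neighbours :: "'a pair_pre_digraph \<Rightarrow> 'a \<Rightarrow> 'a set" where
  "neighbours G v = {u. (v, u) \<in> parcs G}"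

text \<open>
  In a symmetric digraph without parallel arcs and loops, the degree of a vertex is its out-degree.
\<close>

definition biregular_graph ::
    "nat \<Rightarrow> nat \<Rightarrow> 'a pair_pre_digraph \<Rightarrow> 'a set \<Rightarrow> 'a set \<Rightarrow> bool" where
  "biregular_graph a b G EG OG \<longleftrightarrow>
     pair_graph G \<and>
     pverts G = EG \<union> OG \<and> EG \<inter> OG = {} \<and>
     parcs G \<subseteq> EG \<times> OG \<union> OG \<times> EG \<and>
     (\<forall>v\<in>EG. out_degree (with_proj G) v = a) \<and>
     (\<forall>v\<in>OG. out_degree (with_proj G) v = b)"

text \<open>
  Maps are made extensional (\<open>undefined\<close> off the vertex set), so that each function
  from \<open>V(G)\<close> to \<open>V(H)\<close> is counted exactly once.
\<close>

definition Hom :: "'a pair_pre_digraph \<Rightarrow> 'b pair_pre_digraph \<Rightarrow> ('a \<Rightarrow> 'b) set" where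
  "Hom G H = {f \<in> pverts G \<rightarrow>\<^sub>E pverts H. \<forall>u v. (u, v) \<in> parcs G \<longrightarrow> (f u, f v) \<in> parcs H}"

definition list_Hom ::
    "('a \<Rightarrow> 'b set) \<Rightarrow> 'a pair_pre_digraph \<Rightarrow> 'b pair_pre_digraph \<Rightarrow> ('a \<Rightarrow> 'b) set" where
  "list_Hom L G H = {f \<in> Hom G H. \<forall>v\<in>pverts G. f v \<in> L v}"

text \<open>
  \<open>K\<^sub>a\<^sub>,\<^sub>b\<close>: the \<open>a\<close> vertices of degree \<open>b\<close> are \<open>Inl i\<close> with \<open>i < a\<close>,
  the \<open>b\<close> vertices of degree \<open>a\<close> are \<open>Inr k\<close> with \<open>k < b\<close>.
\<close>

definition complete_bipartite :: "nat \<Rightarrow> nat \<Rightarrow> (nat + nat) pair_pre_digraph" where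
  "complete_bipartite a b =
     \<lparr> pverts = Inl ` {..<a} \<union> Inr ` {..<b},
       parcs = Inl ` {..<a} \<times> Inr ` {..<b} \<union> Inr ` {..<b} \<times> Inl ` {..<a} \<rparr>"

lemma complete_bipartite_digraph_complete_bipartite:
  "complete_bipartite_digraph a b (with_proj (complete_bipartite a b))"
  unfolding complete_bipartite_digraph_pair_def
proof (intro conjI exI)
  show "pverts (complete_bipartite a b) = Inl ` {..<a} \<union> Inr ` {..<b}"
    "parcs (complete_bipartite a b) =
      Inl ` {..<a} \<times> Inr ` {..<b} \<union> Inr ` {..<b} \<times> Inl ` {..<a}"
    by (simp_all add: complete_bipartite_def)
qed (auto simp: complete_bipartite_def card_image)

text \<open>
  The list set \<open>\<L>\<^sup>v\<close> on \<open>K\<^sub>a\<^sub>,\<^sub>b\<close>, where \<open>n 0, \<dots>, n (b - 1)\<close> enumerates the neighbours of \<open>v\<close>.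
\<close>

definition local_lists :: "('a \<Rightarrow> 'b set) \<Rightarrow> 'a \<Rightarrow> (nat \<Rightarrow> 'a) \<Rightarrow> nat + nat \<Rightarrow> 'b set" where
  "local_lists L v n = case_sum (\<lambda>i. L v) (\<lambda>k. L (n k))"

end

theory Submission
  imports Defs "HOL-Analysis.Convex"
begin

text \<open>
  Since all edges run between \<open>EG\<close> and \<open>OG\<close>, once the colours \<open>x\<close> of the vertices in \<open>EG\<close>
  are fixed, the vertices of \<open>OG\<close> choose their colours independently: \<open>v\<close> has \<open>c\<^sub>v(x)\<close> choices,
  a number that depends only on the restriction of \<open>x\<close> to the neighbours \<open>N(v)\<close>.  Hence the
  number of list homomorphisms from \<open>G\<close> is \<open>\<Sum>\<^sub>x \<Prod>\<^sub>v c\<^sub>v(x|N(v))\<close>, with \<open>v\<close> running over \<open>OG\<close>.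

  Every \<open>u \<in> EG\<close> lies in exactly \<open>a\<close> of the sets \<open>N(v)\<close>, so each coordinate of \<open>x\<close> occurs in
  exactly \<open>a\<close> factors.  This is the situation of Finner's generalisation of Hoelder's inequality
  (lemma \<open>finner_inequality\<close>), which bounds the sum by the product over \<open>v\<close> of the
  \<open>\<ell>\<^sup>a\<close>-norms \<open>(\<Sum>\<^sub>y c\<^sub>v(y)\<^sup>a)\<^bsup>1/a\<^esup>\<close>, where \<open>y\<close> runs over the colourings of \<open>N(v)\<close>.
  The same count applied to \<open>K\<^sub>a\<^sub>,\<^sub>b\<close>, whose \<open>a\<close> vertices of degree \<open>b\<close> are \<open>a\<close> independent copies
  of \<open>v\<close>, shows that \<open>\<Sum>\<^sub>y c\<^sub>v(y)\<^sup>a\<close> is the number of list homomorphisms from \<open>K\<^sub>a\<^sub>,\<^sub>b\<close>.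
  Both counts are proved only in the direction that the bound requires
  (\<open>card_list_Hom_le\<close> and \<open>sum_extensions_power_le\<close>), so that injections suffice.

  Finner's inequality is proved by summing out one coordinate at a time.  The sum over a single
  coordinate is an instance of Hoelder's inequality for \<open>a\<close> functions with equal exponents
  (\<open>holder_equal_exponents\<close>), which follows from the inequality of arithmetic and geometric
  means.
\<close>

section \<open>Hoelder's and Finner's inequalities\<close>

text \<open>
  After dividing each \<open>g i\<close> by its \<open>\<ell>\<^sup>a\<close>-norm, the inequality of arithmetic and geometric means
  bounds the product at each point by the average of the \<open>a\<close>-th powers, and each
  of those powers now sums to 1.
\<close>

lemma holder_equal_exponents:
  fixes g :: "'i \<Rightarrow> 'x \<Rightarrow> real"
  assumes I: "finite I" "card I = a" "a > 0" and X: "finite X"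
    and nonneg: "\<And>i x. i \<in> I \<Longrightarrow> x \<in> X \<Longrightarrow> g i x \<ge> 0"
  shows "(\<Sum>x\<in>X. \<Prod>i\<in>I. g i x) \<le> (\<Prod>i\<in>I. root a (\<Sum>x\<in>X. g i x ^ a))"
proof -
  define S where "S i = (\<Sum>x\<in>X. g i x ^ a)" for i
  have S_nonneg: "S i \<ge> 0" if "i \<in> I" for i
    unfolding S_def using nonneg that by (intro sum_nonneg) simp
  show ?thesis
  proof (cases "\<exists>i\<in>I. S i = 0")
    case True
    then obtain i where i: "i \<in> I" "S i = 0" by blast
    have "g i x = 0" if "x \<in> X" for x
    proof -
      have "g i x ^ a = 0"
        using i that sum_nonneg_eq_0_iff[OF X, of "\<lambda>x. g i x ^ a"] nonneg
        by (simp add: S_def)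
      then show ?thesis by simp
    qed
    then have "(\<Prod>i\<in>I. g i x) = 0" if "x \<in> X" for x
      using i I that by (auto intro: prod_zero)
    then have "(\<Sum>x\<in>X. \<Prod>i\<in>I. g i x) = 0" by simp
    also have "\<dots> \<le> (\<Prod>i\<in>I. root a (S i))"
      using S_nonneg by (intro prod_nonneg real_root_ge_zero ballI)
    finally show ?thesis by (simp add: S_def)
  next
    case False
    then have S_pos: "S i > 0" if "i \<in> I" for i
      using S_nonneg that by (metis order_less_le)
    define h where "h i x = g i x / root a (S i)" for i x
    have h_nonneg: "h i x \<ge> 0" if "i \<in> I" "x \<in> X" for i x
      using nonneg S_nonneg that by (simp add: h_def real_root_ge_zero)
    have h_sum: "(\<Sum>x\<in>X. h i x ^ a) = 1" if "i \<in> I" for i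
    proof -
      have "(\<Sum>x\<in>X. h i x ^ a) = (\<Sum>x\<in>X. g i x ^ a) / S i"
        using S_nonneg[OF that] \<open>a > 0\<close>
        by (simp add: h_def power_divide sum_divide_distrib)
      then show ?thesis using S_pos[OF that] by (simp add: S_def)
    qed
    have "I \<noteq> {}" using I by auto
    have amgm: "(\<Prod>i\<in>I. h i x) \<le> (\<Sum>i\<in>I. h i x ^ a) / a" if "x \<in> X" for x
    proof -
      have "(\<Prod>i\<in>I. h i x) = root a (\<Prod>i\<in>I. h i x ^ a)"
        using h_nonneg that \<open>a > 0\<close>
        by (simp add: prod_power_distrib[symmetric] real_root_power_cancel prod_nonneg)
      also have "\<dots> \<le> (\<Sum>i\<in>I. h i x ^ a) / a"
        using arith_geom_mean[OF \<open>finite I\<close> \<open>I \<noteq> {}\<close>, of "\<lambda>i. h i x ^ a"] h_nonneg that I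
        by (simp add: root_powr_inverse prod_nonneg sum_divide_distrib)
      finally show ?thesis .
    qed
    have "(\<Sum>x\<in>X. \<Prod>i\<in>I. h i x) \<le> (\<Sum>x\<in>X. (\<Sum>i\<in>I. h i x ^ a) / a)"
      by (intro sum_mono amgm)
    also have "\<dots> = (\<Sum>i\<in>I. \<Sum>x\<in>X. h i x ^ a) / a"
      by (simp add: sum_divide_distrib[symmetric] sum.swap[of _ X])
    also have "\<dots> = 1"
      using h_sum I by simp
    finally have h_bound: "(\<Sum>x\<in>X. \<Prod>i\<in>I. h i x) \<le> 1" .
    have g_eq: "g i x = root a (S i) * h i x" if "i \<in> I" for i x
      using S_pos[OF that] \<open>a > 0\<close> by (simp add: h_def)
    have "(\<Sum>x\<in>X. \<Prod>i\<in>I. g i x) = (\<Prod>i\<in>I. root a (S i)) * (\<Sum>x\<in>X. \<Prod>i\<in>I. h i x)"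
      by (simp add: g_eq prod.distrib sum_distrib_left)
    also have "\<dots> \<le> (\<Prod>i\<in>I. root a (S i))"
      using mult_left_mono[OF h_bound, of "\<Prod>i\<in>I. root a (S i)"] S_nonneg
      by (simp add: prod_nonneg real_root_ge_zero)
    finally show ?thesis by (simp add: S_def)
  qed
qed

lemma sum_PiE_insert:
  assumes "u \<notin> A"
  shows "(\<Sum>x\<in>PiE (insert u A) L. f x) = (\<Sum>x\<in>PiE A L. \<Sum>c\<in>L u. f (x(u := c)))"
proof -
  have "(\<Sum>x\<in>PiE (insert u A) L. f x) = (\<Sum>(c, x)\<in>L u \<times> PiE A L. f (x(u := c)))"
    unfolding PiE_insert_eq
    by (subst sum.reindex[OF inj_combinator[OF assms]]) (simp add: case_prod_unfold)
  also have "\<dots> = (\<Sum>x\<in>PiE A L. \<Sum>c\<in>L u. f (x(u := c)))"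
    by (subst sum.cartesian_product[symmetric]) (rule sum.swap)
  finally show ?thesis .
qed

text \<open>
  The coordinates are summed out one at a time.  The factors \<open>F v\<close> with \<open>u \<notin> N v\<close> are
  constant in coordinate \<open>u\<close>; Hoelder's inequality applies to the \<open>a\<close> remaining ones and replaces each
  by its \<open>\<ell>\<^sup>a\<close>-norm in that coordinate.  This norm is a function of the coordinates in \<open>N v - {u}\<close>, and its
  own \<open>\<ell>\<^sup>a\<close>-norm is that of \<open>F v\<close>.
\<close>

lemma finner_inequality:
  fixes F :: "'v \<Rightarrow> ('u \<Rightarrow> 'c) \<Rightarrow> real"
  assumes "finite A" and V: "finite V" and a: "a > 0"
    and L: "\<And>u. u \<in> A \<Longrightarrow> finite (L u)"
    and N: "\<And>v. v \<in> V \<Longrightarrow> N v \<subseteq> A"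
    and deg: "\<And>u. u \<in> A \<Longrightarrow> card {v \<in> V. u \<in> N v} = a"
    and nonneg: "\<And>v y. v \<in> V \<Longrightarrow> F v y \<ge> 0"
  shows "(\<Sum>x\<in>PiE A L. \<Prod>v\<in>V. F v (restrict x (N v)))
    \<le> (\<Prod>v\<in>V. root a (\<Sum>y\<in>PiE (N v) L. F v y ^ a))"
  using \<open>finite A\<close> L N deg nonneg
proof (induction A arbitrary: N F rule: finite_induct)
  case empty
  then have "N v = {}" if "v \<in> V" for v using that by blast
  then show ?case
    using a empty.prems(4) by (simp add: real_root_power_cancel)
next
  case (insert u A)
  note L = insert.prems(1) and N = insert.prems(2) and deg = insert.prems(3)
    and nonneg = insert.prems(4)
  define N' where "N' v = N v - {u}" for v
  define F' where
    "F' v y = (if u \<in> N v then root a (\<Sum>c\<in>L u. F v (y(u := c)) ^ a) else F v y)" for v y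
  define I where "I = {v \<in> V. u \<in> N v}"
  have I: "finite I" "card I = a" "I \<subseteq> V"
    using V deg[of u] by (auto simp: I_def)
  have sum_nonneg': "(\<Sum>c\<in>L u. F v (y(u := c)) ^ a) \<ge> 0" if "v \<in> V" for v y
    using nonneg that by (intro sum_nonneg) simp
  have F'_nonneg: "F' v y \<ge> 0" if "v \<in> V" for v y
    using nonneg sum_nonneg' that by (simp add: F'_def real_root_ge_zero)

  have step: "(\<Sum>c\<in>L u. \<Prod>v\<in>V. F v (restrict (x(u := c)) (N v)))
      \<le> (\<Prod>v\<in>V. F' v (restrict x (N' v)))" for x
  proof -
    have in_I: "restrict (x(u := c)) (N v) = (restrict x (N' v))(u := c)" if "v \<in> I" for v c
      using that by (auto simp: I_def N'_def restrict_def fun_eq_iff)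
    have notin_I: "restrict (x(u := c)) (N v) = restrict x (N' v)" if "v \<in> V - I" for v c
      using that by (auto simp: I_def N'_def restrict_def fun_eq_iff)
    have split: "(\<Prod>v\<in>V. f v) = (\<Prod>v\<in>V - I. f v) * (\<Prod>v\<in>I. f v)" for f :: "'v \<Rightarrow> real"
      by (rule prod.subset_diff[OF \<open>I \<subseteq> V\<close> V])
    have "(\<Sum>c\<in>L u. \<Prod>v\<in>V. F v (restrict (x(u := c)) (N v)))
      = (\<Prod>v\<in>V - I. F v (restrict x (N' v)))
        * (\<Sum>c\<in>L u. \<Prod>v\<in>I. F v ((restrict x (N' v))(u := c)))"
      by (simp add: split in_I notin_I sum_distrib_left)
    also have "\<dots> \<le> (\<Prod>v\<in>V - I. F v (restrict x (N' v)))
        * (\<Prod>v\<in>I. root a (\<Sum>c\<in>L u. F v ((restrict x (N' v))(u := c)) ^ a))"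
      using I a L nonneg
      by (intro mult_left_mono holder_equal_exponents prod_nonneg) auto
    also have "\<dots> = (\<Prod>v\<in>V. F' v (restrict x (N' v)))"
      unfolding split by (intro arg_cong2[of _ _ _ _ "(*)"] prod.cong) (auto simp: F'_def I_def)
    finally show ?thesis .
  qed

  \<comment> \<open>Summing out coordinate \<open>u\<close> first does not change the norm of a factor.\<close>
  have norm_eq: "(\<Sum>y\<in>PiE (N' v) L. F' v y ^ a) = (\<Sum>y\<in>PiE (N v) L. F v y ^ a)"
    if "v \<in> V" for v
  proof (cases "u \<in> N v")
    case True
    then have "N v = insert u (N' v)" by (auto simp: N'_def)
    then show ?thesis
      using True a sum_nonneg'[OF that] sum_PiE_insert[of u "N' v" "\<lambda>y. F v y ^ a" L]
      by (simp add: N'_def F'_def insert_absorb)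
  next
    case False
    then show ?thesis by (simp add: N'_def F'_def)
  qed

  have "(\<Sum>x\<in>PiE (insert u A) L. \<Prod>v\<in>V. F v (restrict x (N v)))
    = (\<Sum>x\<in>PiE A L. \<Sum>c\<in>L u. \<Prod>v\<in>V. F v (restrict (x(u := c)) (N v)))"
    by (rule sum_PiE_insert[OF \<open>u \<notin> A\<close>])
  also have "\<dots> \<le> (\<Sum>x\<in>PiE A L. \<Prod>v\<in>V. F' v (restrict x (N' v)))"
    by (intro sum_mono step)
  also have "\<dots> \<le> (\<Prod>v\<in>V. root a (\<Sum>y\<in>PiE (N' v) L. F' v y ^ a))"
  proof (rule insert.IH)
    show "card {v \<in> V. w \<in> N' v} = a" if "w \<in> A" for w
    proof -
      have "{v \<in> V. w \<in> N' v} = {v \<in> V. w \<in> N v}"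
        using that \<open>u \<notin> A\<close> by (auto simp: N'_def)
      then show ?thesis using deg that by simp
    qed
    show "N' v \<subseteq> A" if "v \<in> V" for v
      using N[OF that] by (auto simp: N'_def)
  qed (use L F'_nonneg in auto)
  also have "\<dots> = (\<Prod>v\<in>V. root a (\<Sum>y\<in>PiE (N v) L. F v y ^ a))"
    by (simp add: norm_eq)
  finally show ?case .
qed

section \<open>Counting list homomorphisms\<close>

definition extensions ::
    "('a \<Rightarrow> 'b set) \<Rightarrow> 'a pair_pre_digraph \<Rightarrow> 'b pair_pre_digraph \<Rightarrow> 'a \<Rightarrow> ('a \<Rightarrow> 'b) \<Rightarrow> 'b set" where
  "extensions L G H v x = {c \<in> L v. \<forall>u\<in>neighbours G v. (x u, c) \<in> parcs H}"

lemma extensions_restrict: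
  "extensions L G H v (restrict x (neighbours G v)) = extensions L G H v x"
  by (simp add: extensions_def)

lemma finite_list_Hom:
  assumes "finite (pverts G)" "finite (pverts H)"
  shows "finite (list_Hom L G H)"
  by (rule finite_subset[OF _ finite_PiE[OF assms(1), of "\<lambda>_. pverts H"]])
    (use assms in \<open>auto simp: list_Hom_def Hom_def\<close>)

text \<open>
  A homomorphism is determined by its restrictions to the two classes, and its value at
  \<open>v \<in> OG\<close> is compatible with its values on the neighbours of \<open>v\<close>.
\<close>

lemma card_list_Hom_le:
  assumes verts: "pverts G = EG \<union> OG" and fin: "finite EG" "finite OG"
    and nbrs: "\<And>v. v \<in> OG \<Longrightarrow> neighbours G v \<subseteq> EG"
    and sym: "\<And>u v. (u, v) \<in> parcs G \<Longrightarrow> (v, u) \<in> parcs G"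
    and L: "\<And>v. v \<in> EG \<union> OG \<Longrightarrow> finite (L v)"
  shows "card (list_Hom L G H) \<le> (\<Sum>x\<in>PiE EG L. \<Prod>v\<in>OG. card (extensions L G H v x))"
proof -
  define T where "T = (SIGMA x:PiE EG L. PiE OG (\<lambda>v. extensions L G H v x))"
  have fin_ext: "finite (extensions L G H v x)" if "v \<in> OG" for v x
    using L[of v] that by (simp add: extensions_def)
  have "card (list_Hom L G H) \<le> card T"
  proof (rule card_inj_on_le)
    show "inj_on (\<lambda>f. (restrict f EG, restrict f OG)) (list_Hom L G H)"
    proof (rule inj_onI)
      fix f g assume fg: "f \<in> list_Hom L G H" "g \<in> list_Hom L G H"
        and eq: "(restrict f EG, restrict f OG) = (restrict g EG, restrict g OG)"
      have "f w = g w" if "w \<in> pverts G" for w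
        using that verts eq by (auto simp: restrict_def fun_eq_iff) metis+
      then show "f = g"
        using fg by (intro PiE_ext[of _ "pverts G" "\<lambda>_. pverts H"]) (auto simp: list_Hom_def Hom_def)
    qed
    show "(\<lambda>f. (restrict f EG, restrict f OG)) ` list_Hom L G H \<subseteq> T"
    proof (rule image_subsetI)
      fix f assume f: "f \<in> list_Hom L G H"
      have "f v \<in> extensions L G H v (restrict f EG)" if "v \<in> OG" for v
        using f that nbrs[OF that] sym verts
        by (auto simp: extensions_def neighbours_def list_Hom_def Hom_def)
      then show "(restrict f EG, restrict f OG) \<in> T"
        using f verts by (auto simp: T_def list_Hom_def)
    qed
    show "finite T"
      unfolding T_def using fin L fin_ext by (intro finite_SigmaI finite_PiE) auto
  qed
  also have "card T = (\<Sum>x\<in>PiE EG L. \<Prod>v\<in>OG. card (extensions L G H v x))"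
    unfolding T_def using fin L fin_ext
    by (subst card_SigmaI) (auto intro!: finite_PiE simp: card_PiE)
  finally show ?thesis .
qed

text \<open>
  A colouring \<open>y\<close> of the neighbours of \<open>v\<close> together with \<open>a\<close> independently chosen
  extensions of \<open>y\<close> to \<open>v\<close> is a homomorphism from \<open>K\<^sub>a\<^sub>,\<^sub>b\<close>.
\<close>

lemma sum_extensions_power_le:
  fixes L :: "'a \<Rightarrow> 'b set" and n :: "nat \<Rightarrow> 'a"
  assumes H: "finite (pverts H)" "\<And>c d. (c, d) \<in> parcs H \<Longrightarrow> (d, c) \<in> parcs H"
    and n: "bij_betw n {..<b} (neighbours G v)"
    and L: "L v \<subseteq> pverts H" "\<And>u. u \<in> neighbours G v \<Longrightarrow> L u \<subseteq> pverts H"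
  shows "(\<Sum>y\<in>PiE (neighbours G v) L. card (extensions L G H v y) ^ a)
    \<le> card (list_Hom (local_lists L v n) (complete_bipartite a b) H)"
proof -
  define N where "N = neighbours G v"
  define T where "T = (SIGMA y:PiE N L. {..<a} \<rightarrow>\<^sub>E extensions L G H v y)"
  \<comment> \<open>On \<open>T\<close>, \<open>z\<close> is already \<open>undefined\<close> from \<open>a\<close> on, so only the second case needs a guard.\<close>
  define glue :: "('a \<Rightarrow> 'b) \<times> (nat \<Rightarrow> 'b) \<Rightarrow> nat + nat \<Rightarrow> 'b" where
    "glue = (\<lambda>(y, z). case_sum z (\<lambda>k. if k < b then y (n k) else undefined))"
  have n_in: "n k \<in> N" if "k < b" for k
    using n that by (auto simp: N_def bij_betw_def)
  have n_surj: "\<exists>k<b. n k = u" if "u \<in> N" for u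
  proof -
    have "u \<in> n ` {..<b}"
      using n that by (simp add: N_def bij_betw_def)
    then show ?thesis by auto
  qed
  have "finite N"
    using n bij_betw_finite by (auto simp: N_def)
  have fin_ext: "finite (extensions L G H v y)" for y
    using L(1) H(1) by (auto simp: extensions_def intro: finite_subset)
  have fin_PiE: "finite (PiE N L)"
    using \<open>finite N\<close> L(2) H(1) by (intro finite_PiE) (auto simp: N_def intro: finite_subset)
  have "(\<Sum>y\<in>PiE N L. card (extensions L G H v y) ^ a) = card T"
    unfolding T_def using fin_PiE fin_ext
    by (subst card_SigmaI) (auto intro!: finite_PiE simp: card_funcsetE)
  also have "\<dots> \<le> card (list_Hom (local_lists L v n) (complete_bipartite a b) H)"
  proof (rule card_inj_on_le)
    show "inj_on glue T"
    proof (rule inj_onI, safe)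
      fix y z y' z'
      assume T: "(y, z) \<in> T" "(y', z') \<in> T" and eq: "glue (y, z) = glue (y', z')"
      show "z = z'"
      proof
        show "z i = z' i" for i
          using fun_cong[OF eq, of "Inl i"] by (simp add: glue_def)
      qed
      have y_eq: "y (n k) = y' (n k)" if "k < b" for k
        using fun_cong[OF eq, of "Inr k"] that by (simp add: glue_def)
      have "y u = y' u" if "u \<in> N" for u
      proof -
        obtain k where "k < b" "n k = u" using n_surj[OF \<open>u \<in> N\<close>] by blast
        then show ?thesis using y_eq by metis
      qed
      then show "y = y'"
        using T by (intro PiE_ext[of y N L y']) (auto simp: T_def)
    qed
    show "glue ` T \<subseteq> list_Hom (local_lists L v n) (complete_bipartite a b) H"
    proof (rule image_subsetI)
      fix p assume "p \<in> T"
      then obtain y z where p: "p = (y, z)" and y: "y \<in> PiE N L"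
        and z: "z \<in> {..<a} \<rightarrow>\<^sub>E extensions L G H v y"
        by (auto simp: T_def)
      have y_in: "y (n k) \<in> L (n k)" if "k < b" for k
        using y n_in[OF that] by auto
      have y_verts: "y (n k) \<in> pverts H" if "k < b" for k
        using L(2) y_in[OF that] n_in[OF that] by (auto simp: N_def)
      have z_in: "z i \<in> L v" if "i < a" for i
        using z that by (auto simp: extensions_def)
      have arc: "(y (n k), z i) \<in> parcs H" if "i < a" "k < b" for i k
        using PiE_mem[OF z, of i] n_in[OF that(2)] that by (auto simp: extensions_def N_def)
      have "glue p \<in> pverts (complete_bipartite a b) \<rightarrow>\<^sub>E pverts H"
      proof (rule PiE_I)
        show "glue p w \<in> pverts H" if "w \<in> pverts (complete_bipartite a b)" for w
          using that y_verts z_in L(1)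
          by (auto simp: complete_bipartite_def glue_def p)
        show "glue p w = undefined" if "w \<notin> pverts (complete_bipartite a b)" for w
          using that PiE_arb[OF z]
          by (cases w) (auto simp: complete_bipartite_def glue_def p)
      qed
      then show "glue p \<in> list_Hom (local_lists L v n) (complete_bipartite a b) H"
        using y_in z_in arc H(2)
        by (auto simp: list_Hom_def Hom_def local_lists_def complete_bipartite_def glue_def p)
    qed
    show "finite (list_Hom (local_lists L v n) (complete_bipartite a b) H)"
      using H(1) by (intro finite_list_Hom) (simp_all add: complete_bipartite_def)
  qed
  finally show ?thesis by (simp add: N_def)
qed

section \<open>Biregular graphs\<close>

lemma pair_pseudo_graph_arc_sym:
  assumes "pair_pseudo_graph G" "(u, v) \<in> parcs G"
  shows "(v, u) \<in> parcs G"
proof -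
  interpret pair_pseudo_graph G by fact
  show ?thesis using arcs_symmetric assms(2) by simp
qed

lemma out_degree_eq_card_neighbours:
  "out_degree (with_proj G) v = card (neighbours G v)"
proof -
  have "out_arcs (with_proj G) v = Pair v ` neighbours G v"
    by (auto simp: out_arcs_def neighbours_def)
  then show ?thesis
    by (simp add: out_degree_def card_image inj_on_def)
qed

theorem theorem1p4:
  fixes H :: "'b pair_pre_digraph" and G :: "'a pair_pre_digraph"
    and a b :: nat and EG OG :: "'a set"
    and L :: "'a \<Rightarrow> 'b set" and n :: "'a \<Rightarrow> nat \<Rightarrow> 'a"
  assumes "pair_pseudo_graph H" and "pverts H \<noteq> {}"
    and "a \<ge> 1" and "b \<ge> 1"
    and "biregular_graph a b G EG OG" and "pverts G \<noteq> {}"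
    and "\<And>v. v \<in> pverts G \<Longrightarrow> L v \<subseteq> pverts H"
    and "\<And>v. v \<in> OG \<Longrightarrow> bij_betw (n v) {..<b} (neighbours G v)"
  shows "real (card (list_Hom L G H)) \<le>
    (\<Prod>v\<in>OG. real (card (list_Hom (local_lists L v (n v)) (complete_bipartite a b) H)) powr (1 / real a))"
proof -
  have G: "pair_graph G" and verts: "pverts G = EG \<union> OG" and disj: "EG \<inter> OG = {}"
    and arcs: "parcs G \<subseteq> EG \<times> OG \<union> OG \<times> EG"
    and deg: "\<And>u. u \<in> EG \<Longrightarrow> card (neighbours G u) = a"
    using assms(5) by (auto simp: biregular_graph_def out_degree_eq_card_neighbours)
  interpret G: pair_graph G by fact
  interpret H: pair_pseudo_graph H by fact
  have fin: "finite EG" "finite OG" "finite (pverts H)"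
    using G.pair_finite_verts H.pair_finite_verts verts by simp_all
  have sym: "(v, u) \<in> parcs G" if "(u, v) \<in> parcs G" for u v
    using pair_pseudo_graph_arc_sym[OF G.pair_pseudo_graph_axioms that] .
  have finL: "finite (L v)" if "v \<in> EG \<union> OG" for v
    using assms(7)[of v] that verts fin(3) finite_subset by blast
  have nbrs: "neighbours G v \<subseteq> EG" if "v \<in> OG" for v
    using arcs disj that by (auto simp: neighbours_def)
  have occurrences: "card {v \<in> OG. u \<in> neighbours G v} = a" if "u \<in> EG" for u
  proof -
    have "{v \<in> OG. u \<in> neighbours G v} = neighbours G u"
      using arcs disj that sym by (auto simp: neighbours_def)
    then show ?thesis using deg[OF that] by simp
  qed
  let ?c = "\<lambda>v y. real (card (extensions L G H v y))"
  let ?K = "\<lambda>v. card (list_Hom (local_lists L v (n v)) (complete_bipartite a b) H)"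
  have "real (card (list_Hom L G H)) \<le> real (\<Sum>x\<in>PiE EG L. \<Prod>v\<in>OG. card (extensions L G H v x))"
    using card_list_Hom_le[OF verts fin(1,2) nbrs sym finL] by (rule of_nat_mono)
  also have "\<dots> = (\<Sum>x\<in>PiE EG L. \<Prod>v\<in>OG. ?c v (restrict x (neighbours G v)))"
    by (simp add: extensions_restrict)
  also have "\<dots> \<le> (\<Prod>v\<in>OG. root a (\<Sum>y\<in>PiE (neighbours G v) L. ?c v y ^ a))"
    using assms(3) by (intro finner_inequality fin finL nbrs occurrences) auto
  also have "\<dots> \<le> (\<Prod>v\<in>OG. root a (real (?K v)))"
  proof (rule prod_mono, intro conjI)
    fix v assume v: "v \<in> OG"
    show "0 \<le> root a (\<Sum>y\<in>PiE (neighbours G v) L. ?c v y ^ a)"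
      by (intro real_root_ge_zero sum_nonneg) simp
    have "(\<Sum>y\<in>PiE (neighbours G v) L. card (extensions L G H v y) ^ a) \<le> ?K v"
    proof (rule sum_extensions_power_le[OF fin(3) _ assms(8)[OF v]])
      show "(d, c) \<in> parcs H" if "(c, d) \<in> parcs H" for c d
        using pair_pseudo_graph_arc_sym[OF assms(1) that] .
      show "L v \<subseteq> pverts H"
        using assms(7) v verts by blast
      show "L u \<subseteq> pverts H" if "u \<in> neighbours G v" for u
        using assms(7) nbrs[OF v] that verts by blast
    qed
    then have "real (\<Sum>y\<in>PiE (neighbours G v) L. card (extensions L G H v y) ^ a) \<le> real (?K v)"
      by (rule of_nat_mono)
    then show "root a (\<Sum>y\<in>PiE (neighbours G v) L. ?c v y ^ a) \<le> root a (real (?K v))"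
      using assms(3) by simp
  qed
  also have "\<dots> = (\<Prod>v\<in>OG. real (?K v) powr (1 / real a))"
    using assms(3) by (simp add: root_powr_inverse)
  finally show ?thesis .
qed

end
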